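(* Let $\mathcal X$ be a normed vector space, $\mathcal D$ a subset of $\mathcal X$, and $W:\mathcal D\to\mathbb R$ a functional such that: (1) there exists $\gamma\ge0$ such that $W(x)\ge-\gamma$ for every $x\in\mathcal D$; (2) every $W$-bounded sequence in $\mathcal D$ contains a subsequence converging (in norm) to an element of $\mathcal D$. Let $J,J_n:\mathcal D\to\mathbb R$, $n=1,2,\dots$, be functionals such that $J$ is $W$-subsequentially lower semicontinuous and $\{J_n\}$ is $W$-coercive and $W$-uniformly consistent for $J$. Suppose further that $J$ has a unique global minimizer $\bar x\in\mathcal D$ and that each functional $J_n$ possesses a global minimizer $x_n$ on $\mathcal D$ (not necessarily unique). Then $x_n\to\bar x$ in norm.
   Context: A sequence or subset of $\mathcal D$ is $W$-bounded if there is a constant $k<\infty$ with $|W(x)|\le k$ for all its elements $x$. $J$ is $W$-subsequentially lower semicontinuous if for every $W$-bounded sequence $\{x_n\}\subset\mathcal D$ converging in norm to some $x\in\mathcal D$ there is a subsequence $\{x_{n_j}\}$ with $J(x)\le\liminf_{j\to\infty}J(x_{n_j})$. $\{J_n\}$ is $W$-coercive if $\lim_{n\to\infty}J_n(x_n)=+\infty$ for every sequence $\{x_n\}\subset\mathcal D$ with $\lim_{n\to\infty}W(x_n)=+\infty$. $\{J_n\}$ is $W$-uniformly consistent for $J$ if for any $c>0$ and $\epsilon>0$ there exists $N=N(c,\epsilon)$ such that $|J_n(x)-J(x)|<\epsilon$ for every $n\ge N$ and every $x\in\mathcal D$ with $|W(x)|\le c$. *)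

theory Defs
  imports "HOL-Analysis.Analysis"
begin

text \<open>
  Functionals on \<open>D\<close> are total functions of which only the values on \<open>D\<close> are used.
  A sequence \<open>x\<close> is \<open>W\<close>-bounded iff the set \<open>range x\<close> is. The families \<open>Jn\<close> are indexed
  by \<open>n \<ge> 1\<close>; the value at index 0 plays no role.
\<close>

definition W_bounded :: "'a set \<Rightarrow> ('a \<Rightarrow> real) \<Rightarrow> 'a set \<Rightarrow> bool" where
  "W_bounded D W S \<longleftrightarrow> S \<subseteq> D \<and> (\<exists>k. \<forall>x\<in>S. \<bar>W x\<bar> \<le> k)"

text \<open>The limit inferior is taken in the extended reals, since it may be infinite.\<close>

definition W_subseq_lsc ::
    "'a::real_normed_vector set \<Rightarrow> ('a \<Rightarrow> real) \<Rightarrow> ('a \<Rightarrow> real) \<Rightarrow> bool" where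
  "W_subseq_lsc D W J \<longleftrightarrow>
     (\<forall>x l. W_bounded D W (range x) \<longrightarrow> l \<in> D \<longrightarrow> x \<longlonglongrightarrow> l \<longrightarrow>
        (\<exists>r::nat \<Rightarrow> nat. strict_mono r \<and> ereal (J l) \<le> liminf (\<lambda>j. ereal (J (x (r j))))))"

definition W_coercive :: "'a set \<Rightarrow> ('a \<Rightarrow> real) \<Rightarrow> (nat \<Rightarrow> 'a \<Rightarrow> real) \<Rightarrow> bool" where
  "W_coercive D W Jn \<longleftrightarrow>
     (\<forall>x. (\<forall>n\<ge>1. x n \<in> D) \<longrightarrow> filterlim (\<lambda>n. W (x n)) at_top sequentially \<longrightarrow>
        filterlim (\<lambda>n. Jn n (x n)) at_top sequentially)"

definition W_uniformly_consistent ::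
    "'a set \<Rightarrow> ('a \<Rightarrow> real) \<Rightarrow> (nat \<Rightarrow> 'a \<Rightarrow> real) \<Rightarrow> ('a \<Rightarrow> real) \<Rightarrow> bool" where
  "W_uniformly_consistent D W Jn J \<longleftrightarrow>
     (\<forall>c>0. \<forall>\<epsilon>>0. \<exists>N\<ge>1. \<forall>n\<ge>N. \<forall>x\<in>D. \<bar>W x\<bar> \<le> c \<longrightarrow> \<bar>Jn n x - J x\<bar> < \<epsilon>)"

end

theory Submission
  imports Defs
begin

text \<open>
  The argument is the direct method. Comparison with the competitor \<open>xbar\<close> gives
  \<open>Jn n (x n) \<le> Jn n xbar\<close>, and consistency makes the right-hand side converge to
  \<open>J xbar\<close>. So the minimal values stay bounded above, and coercivity then prevents
  \<open>W (x n)\<close> from being unbounded (\<open>W_bounded_minimizers\<close>). From some index on, the minimizers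
  therefore lie in one sublevel set of \<open>\<bar>W\<bar>\<close>, where \<open>Jn\<close> is uniformly close to \<open>J\<close>. Hence
  \<open>J (x n) \<le> J xbar + \<epsilon>\<close> for all large \<open>n\<close>, that is, \<open>x\<close> is a minimizing sequence
  for \<open>J\<close> itself (\<open>minimizers_are_minimizing_sequence\<close>). By compactness of the sublevel set,
  each subsequence of \<open>x\<close> has a further subsequence with a limit in \<open>D\<close>; by lower
  semicontinuity that limit minimizes \<open>J\<close>, and by uniqueness it is \<open>xbar\<close>. A sequence all
  of whose subsequences cluster at \<open>xbar\<close> converges to \<open>xbar\<close>.

  The delicate point is coercivity, which speaks of whole sequences only, whereas failure
  of boundedness yields \<open>W \<longlonglongrightarrow> \<infinity>\<close> merely along a subsequence. The lemma
  \<open>W_coercive_subseq\<close> bridges this gap.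
\<close>

text \<open>
  The full sequence to which coercivity is applied must have \<open>u k\<close> at position \<open>r k\<close>. The
  remaining positions \<open>n\<close> are filled with \<open>u n\<close> itself, which keeps \<open>W\<close> tending to infinity.
\<close>
lemma W_coercive_subseq:
  fixes r :: "nat \<Rightarrow> nat"
  assumes "W_coercive D W Jn" and r: "strict_mono r" and "\<And>k. u k \<in> D"
    and W_top: "filterlim (\<lambda>k. W (u k)) at_top sequentially"
  shows "filterlim (\<lambda>k. Jn (r k) (u k)) at_top sequentially"
proof -
  define y where "y n = (if n \<in> range r then u (inv r n) else u n)" for n
  have inj: "inj r" using r by (rule strict_mono_imp_inj_on)
  have y_r: "y (r k) = u k" for k
    by (simp add: y_def inj)
  have "filterlim (\<lambda>n. W (y n)) at_top sequentially"
    unfolding filterlim_at_top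
  proof
    fix Z
    obtain K where K: "\<And>k. k \<ge> K \<Longrightarrow> Z \<le> W (u k)"
      using W_top unfolding filterlim_at_top eventually_sequentially by blast
    have "Z \<le> W (y n)" if n: "n \<ge> r K" for n
    proof (cases "n \<in> range r")
      case True
      then obtain k where k: "n = r k" by blast
      with n r have "k \<ge> K" by (simp add: strict_mono_less_eq)
      then show ?thesis using K y_r k by simp
    next
      case False
      have "K \<le> n" using seq_suble[OF r, of K] n by linarith
      then show ?thesis using False K by (simp add: y_def)
    qed
    then show "\<forall>\<^sub>F n in sequentially. Z \<le> W (y n)"
      unfolding eventually_sequentially by blast
  qed
  moreover have "\<forall>n\<ge>1. y n \<in> D"
    using assms(3) by (simp add: y_def)
  ultimately have "filterlim (\<lambda>n. Jn n (y n)) at_top sequentially"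
    using assms(1) unfolding W_coercive_def by blast
  from filterlim_compose[OF this filterlim_subseq[OF r]] show ?thesis
    by (simp add: y_r)
qed

lemma unbounded_above_subseq:
  fixes f :: "nat \<Rightarrow> real"
  assumes "\<nexists>B. \<forall>\<^sub>F n in sequentially. f n \<le> B"
  obtains r where "strict_mono r" "\<And>k. r k \<ge> 1"
    "filterlim (\<lambda>k. f (r k)) at_top sequentially"
proof -
  have "\<exists>n>N. f n > real N" for N
  proof (rule ccontr)
    assume "\<not> ?thesis"
    then have "\<forall>n\<ge>Suc N. f n \<le> real N" by (meson Suc_le_eq not_less)
    then show False using assms unfolding eventually_sequentially by blast
  qed
  then obtain g where g: "\<And>N. g N > N" "\<And>N. f (g N) > real N" by metis
  define r where "r = rec_nat (g 0) (\<lambda>_. g)"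
  have r_simps: "r 0 = g 0" "r (Suc k) = g (r k)" for k
    by (simp_all add: r_def)
  have mono: "strict_mono r"
    using g(1) by (simp add: strict_mono_Suc_iff r_simps)
  have pos: "r k \<ge> 1" for k
    using g(1)[of 0] g(1)[of "r (k - 1)"] r_simps by (cases k) auto
  have "real k \<le> f (r (Suc k))" for k
    using g(2)[of "r k"] seq_suble[OF mono, of k] by (simp add: r_simps)
  then have "filterlim (\<lambda>k. f (r (Suc k))) at_top sequentially"
    by (intro filterlim_at_top_mono[OF filterlim_real_sequentially]) simp
  then have "filterlim (\<lambda>k. f (r k)) at_top sequentially"
    using filterlim_sequentially_Suc[of "\<lambda>k. f (r k)"] by simp
  with mono pos show thesis using that by blast
qed

lemma W_uniformly_consistentD:
  assumes "W_uniformly_consistent D W Jn J" and "\<epsilon> > 0"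
  shows "\<forall>\<^sub>F n in sequentially. \<forall>y\<in>D. \<bar>W y\<bar> \<le> c \<longrightarrow> \<bar>Jn n y - J y\<bar> < \<epsilon>"
proof -
  \<comment> \<open>consistency is available for positive bounds only, so \<open>c\<close> is enlarged\<close>
  obtain N where N: "\<forall>n\<ge>N. \<forall>y\<in>D. \<bar>W y\<bar> \<le> max c 1 \<longrightarrow> \<bar>Jn n y - J y\<bar> < \<epsilon>"
    using assms unfolding W_uniformly_consistent_def
    by (metis less_max_iff_disj zero_less_one)
  show ?thesis
    unfolding eventually_sequentially
    by (intro exI[of _ N]) (use N in \<open>auto simp: le_max_iff_disj\<close>)
qed

text \<open>
  If \<open>W\<close> were unbounded above along \<open>x\<close>, then on a subsequence the minimal values would tend
  to infinity, although they lie below the values at the fixed competitor \<open>p\<close>, which are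
  eventually at most \<open>J p + 1\<close>.
\<close>
lemma W_bounded_minimizers:
  fixes W J :: "'a \<Rightarrow> real"
  assumes below: "\<forall>y\<in>D. W y \<ge> - \<gamma>"
    and coercive: "W_coercive D W Jn"
    and consistent: "W_uniformly_consistent D W Jn J"
    and p: "p \<in> D"
    and x_min: "\<And>n. n \<ge> 1 \<Longrightarrow> is_arg_min (Jn n) (\<lambda>y. y \<in> D) (x n)"
  shows "\<exists>B. \<forall>\<^sub>F n in sequentially. \<bar>W (x n)\<bar> \<le> B"
proof -
  have x_D: "x n \<in> D" if "n \<ge> 1" for n
    using x_min[OF that] by (simp add: is_arg_min_def)
  have "\<exists>B. \<forall>\<^sub>F n in sequentially. W (x n) \<le> B"
  proof (rule ccontr)
    assume "\<not> ?thesis"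
    then obtain r where r: "strict_mono r" "\<And>k. r k \<ge> 1"
        "filterlim (\<lambda>k. W (x (r k))) at_top sequentially"
      using unbounded_above_subseq[of "\<lambda>n. W (x n)"] by blast
    have "filterlim (\<lambda>k. Jn (r k) (x (r k))) at_top sequentially"
      by (rule W_coercive_subseq[OF coercive r(1) _ r(3)]) (rule x_D[OF r(2)])
    then have "\<forall>\<^sub>F k in sequentially. J p + 1 < Jn (r k) (x (r k))"
      by (simp add: filterlim_at_top_dense)
    moreover have "\<forall>\<^sub>F n in sequentially. Jn n p \<le> J p + 1"
      using W_uniformly_consistentD[OF consistent zero_less_one, of "\<bar>W p\<bar>"]
      by eventually_elim (use p in force)
    then have "\<forall>\<^sub>F k in sequentially. Jn (r k) p \<le> J p + 1"
      by (rule eventually_subseq[OF r(1)])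
    ultimately have "\<forall>\<^sub>F k in sequentially. False"
    proof eventually_elim
      case (elim k)
      then show ?case using x_min[OF r(2)[of k]] p by (force simp: is_arg_min_def)
    qed
    then show False by simp
  qed
  then obtain B where "\<forall>\<^sub>F n in sequentially. W (x n) \<le> B" by blast
  then have "\<forall>\<^sub>F n in sequentially. \<bar>W (x n)\<bar> \<le> max B \<gamma>"
    using eventually_ge_at_top[of 1]
  proof eventually_elim
    case (elim n)
    then show ?case using below x_D[of n] by fastforce
  qed
  then show ?thesis ..
qed

text \<open>
  On a common sublevel set of \<open>\<bar>W\<bar>\<close> that contains both \<open>x n\<close> and \<open>p\<close>, passing from \<open>J\<close> to
  \<open>Jn\<close> and back costs \<open>\<epsilon> / 2\<close> each time.
\<close>
lemma minimizers_are_minimizing_sequence: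
  assumes consistent: "W_uniformly_consistent D W Jn J"
    and bounded: "\<forall>\<^sub>F n in sequentially. \<bar>W (x n)\<bar> \<le> B"
    and p: "p \<in> D"
    and x_min: "\<And>n. n \<ge> 1 \<Longrightarrow> is_arg_min (Jn n) (\<lambda>y. y \<in> D) (x n)"
    and "\<epsilon> > 0"
  shows "\<forall>\<^sub>F n in sequentially. J (x n) \<le> J p + \<epsilon>"
proof -
  have "\<epsilon> / 2 > 0" using \<open>\<epsilon> > 0\<close> by simp
  from W_uniformly_consistentD[OF consistent this, of "max B \<bar>W p\<bar>"]
    bounded eventually_ge_at_top[of 1]
  show ?thesis
  proof eventually_elim
    case (elim n)
    then have "x n \<in> D" "Jn n (x n) \<le> Jn n p"
      using x_min[of n] p by (force simp: is_arg_min_def)+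
    moreover have "\<bar>Jn n (x n) - J (x n)\<bar> < \<epsilon> / 2" "\<bar>Jn n p - J p\<bar> < \<epsilon> / 2"
      using elim p \<open>x n \<in> D\<close> by auto
    ultimately show ?case by linarith
  qed
qed

lemma minimizing_sequence_limit:
  assumes lsc: "W_subseq_lsc D W J"
    and "W_bounded D W (range z)" "l \<in> D" "z \<longlonglongrightarrow> l"
    and minimizing: "\<And>\<epsilon>. \<epsilon> > 0 \<Longrightarrow> \<forall>\<^sub>F n in sequentially. J (z n) \<le> m + \<epsilon>"
  shows "J l \<le> m"
proof (rule field_le_epsilon)
  fix \<epsilon> :: real
  assume "\<epsilon> > 0"
  obtain t :: "nat \<Rightarrow> nat" where t: "strict_mono t"
      "ereal (J l) \<le> liminf (\<lambda>j. ereal (J (z (t j))))"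
    using assms(2-4) lsc unfolding W_subseq_lsc_def by blast
  note t(2)
  also have "liminf (\<lambda>j. ereal (J (z (t j)))) \<le> liminf (\<lambda>j::nat. ereal (m + \<epsilon>))"
    using eventually_subseq[OF t(1) minimizing[OF \<open>\<epsilon> > 0\<close>]]
    by (intro Liminf_mono) simp
  also have "\<dots> = ereal (m + \<epsilon>)"
    by (simp add: Liminf_const)
  finally show "J l \<le> m + \<epsilon>" by simp
qed

theorem theorem3p10:
  fixes D :: "'a::real_normed_vector set"
    and W J :: "'a \<Rightarrow> real"
    and Jn :: "nat \<Rightarrow> 'a \<Rightarrow> real"
    and xbar :: 'a
    and x :: "nat \<Rightarrow> 'a"
  assumes W_below: "\<exists>\<gamma>\<ge>0. \<forall>y\<in>D. W y \<ge> - \<gamma>"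
    and W_compact: "\<And>y :: nat \<Rightarrow> 'a. W_bounded D W (range y) \<Longrightarrow>
          \<exists>l\<in>D. \<exists>r::nat \<Rightarrow> nat. strict_mono r \<and> (\<lambda>j. y (r j)) \<longlonglongrightarrow> l"
    and lsc: "W_subseq_lsc D W J"
    and coercive: "W_coercive D W Jn"
    and consistent: "W_uniformly_consistent D W Jn J"
    and xbar_min: "is_arg_min J (\<lambda>y. y \<in> D) xbar"
    and xbar_unique: "\<And>y. is_arg_min J (\<lambda>z. z \<in> D) y \<Longrightarrow> y = xbar"
    and x_min: "\<And>n. n \<ge> 1 \<Longrightarrow> is_arg_min (Jn n) (\<lambda>y. y \<in> D) (x n)"
  shows "x \<longlonglongrightarrow> xbar"
proof (rule tendstoI, rule ccontr)
  fix e :: real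
  assume "e > 0" and far: "\<not> (\<forall>\<^sub>F n in sequentially. dist (x n) xbar < e)"
  have xbar_D: "xbar \<in> D" and xbar_le: "\<And>y. y \<in> D \<Longrightarrow> J xbar \<le> J y"
    using xbar_min by (force simp: is_arg_min_def)+
  obtain \<gamma> where "\<forall>y\<in>D. W y \<ge> - \<gamma>" using W_below by blast
  from W_bounded_minimizers[OF this coercive consistent xbar_D x_min]
  obtain B where B: "\<forall>\<^sub>F n in sequentially. \<bar>W (x n)\<bar> \<le> B" by blast
  then obtain N where N: "\<And>n. n \<ge> N \<Longrightarrow> \<bar>W (x n)\<bar> \<le> B"
    unfolding eventually_sequentially by blast

  \<comment> \<open>a subsequence that stays away from \<open>xbar\<close>, started late enough to be \<open>W\<close>-bounded\<close>
  define A where "A = {n. n \<ge> max N 1 \<and> e \<le> dist (x n) xbar}"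
  have "infinite A"
    unfolding infinite_nat_iff_unbounded_le
  proof
    fix m
    obtain n where "n \<ge> max m (max N 1)" "e \<le> dist (x n) xbar"
      using far unfolding eventually_sequentially not_less[symmetric] by blast
    then show "\<exists>n\<ge>m. n \<in> A" unfolding A_def by auto
  qed
  define r where "r = enumerate A"
  have r: "strict_mono r" "\<And>k. r k \<in> A"
    using \<open>infinite A\<close> by (simp_all add: r_def strict_mono_enumerate enumerate_in_set)
  have bounded: "W_bounded D W (range (\<lambda>k. x (r k)))"
    unfolding W_bounded_def
  proof
    show "range (\<lambda>k. x (r k)) \<subseteq> D"
      using r(2) x_min by (auto simp: A_def is_arg_min_def)
    show "\<exists>k. \<forall>y\<in>range (\<lambda>k. x (r k)). \<bar>W y\<bar> \<le> k"
      using r(2) N by (intro exI[of _ B]) (auto simp: A_def)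
  qed
  from W_compact[OF this]
  obtain l s where l: "l \<in> D" and s: "strict_mono (s :: nat \<Rightarrow> nat)"
    and lim: "(\<lambda>j. x (r (s j))) \<longlonglongrightarrow> l" by blast
  have "strict_mono (\<lambda>j. r (s j))"
    using strict_mono_o[OF r(1) s] by (simp add: o_def)
  note minimizing = eventually_subseq[OF this
      minimizers_are_minimizing_sequence[OF consistent B xbar_D x_min]]
  have "W_bounded D W (range (\<lambda>j. x (r (s j))))"
    using bounded unfolding W_bounded_def by blast
  from minimizing_sequence_limit[OF lsc this l lim minimizing]
  have "J l \<le> J xbar" by simp
  then have "is_arg_min J (\<lambda>z. z \<in> D) l"
    using l xbar_le by (force simp: is_arg_min_def)
  then have "l = xbar" by (rule xbar_unique)
  with lim \<open>e > 0\<close> have "\<forall>\<^sub>F j in sequentially. dist (x (r (s j))) xbar < e"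
    by (simp add: tendstoD)
  moreover have "e \<le> dist (x (r (s j))) xbar" for j
    using r(2)[of "s j"] by (simp add: A_def)
  ultimately have "\<forall>\<^sub>F j in sequentially. False"
    by (simp add: not_less[symmetric])
  then show False by simp
qed

end
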